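(* Let $t\ge1$ and let $G$ be a $\chi_t$-critical graph whose $t$-complement $\overline{G}^t$ is connected. Then for every vertex $v$ of $G$ there is an optimal $\mathcal{SD}_t$-coloring $\varphi$ of $G$ such that $I(\varphi)=\{v\}$.
   Context: All graphs are finite, undirected, loopless, and may have multiple edges; $\mu_G(u,v)$ is the number of edges joining $u,v$. A graph is strictly $t$-degenerate if every non-empty subgraph $H$ has a vertex of degree (with multiplicity) at most $t-1$ in $H$. An $\mathcal{SD}_t$-coloring of $G$ is a map $\varphi:V(G)\to\Gamma$ such that each color class induces a strictly $t$-degenerate subgraph; $\chi_t(G)$ is the least number of colors in such a coloring; $\varphi$ is optimal if its number of non-empty color classes equals $\chi_t(G)$. $I(\varphi)$ is the set of vertices $v$ whose color class is $\{v\}$. $G$ is $\chi_t$-critical if $\chi_t(G')<\chi_t(G)$ for every proper subgraph $G'$ (such $G$ has all multiplicities at most $t$). The $t$-complement $\overline{G}^t$ of a graph $G$ with all multiplicities at most $t$ is the graph on $V(G)$ with $\mu_{\overline{G}^t}(u,v)=t-\mu_G(u,v)$ for all distinct $u,v$. *)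

theory Defs
  imports Main "HOL-Library.FuncSet"
begin

text \<open>
  A multigraph is given by its vertices and the number of edges joining each pair of vertices;
  parallel edges carry no identity. Since multiplicities vanish outside the vertex set, two
  multigraphs are equal as records iff they have the same vertices and the same multiplicities.
\<close>

record 'a mgraph =
  verts :: "'a set"
  mult :: "'a \<Rightarrow> 'a \<Rightarrow> nat"

locale multigraph =
  fixes G :: "'a mgraph"
  assumes finite_verts: "finite (verts G)"
    and mult_sym: "mult G u v = mult G v u"
    and loopless: "mult G v v = 0"
    and mult_outside: "u \<notin> verts G \<Longrightarrow> mult G u v = 0"

definition subgraph :: "'a mgraph \<Rightarrow> 'a mgraph \<Rightarrow> bool" where
  "subgraph H G \<longleftrightarrow>
     multigraph H \<and> verts H \<subseteq> verts G \<and> (\<forall>u v. mult H u v \<le> mult G u v)"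

definition induced_subgraph :: "'a mgraph \<Rightarrow> 'a set \<Rightarrow> 'a mgraph" where
  "induced_subgraph G X =
     \<lparr> verts = verts G \<inter> X,
       mult = (\<lambda>u v. if u \<in> X \<and> v \<in> X then mult G u v else 0) \<rparr>"

definition vdegree :: "'a mgraph \<Rightarrow> 'a \<Rightarrow> nat" where
  "vdegree G v = (\<Sum>u\<in>verts G. mult G v u)"

text \<open>The bound \<open>< t\<close> is the bound \<open>\<le> t - 1\<close> without truncated subtraction at \<open>t = 0\<close>.\<close>

definition strictly_degenerate :: "nat \<Rightarrow> 'a mgraph \<Rightarrow> bool" where
  "strictly_degenerate t G \<longleftrightarrow>
     (\<forall>H. subgraph H G \<and> verts H \<noteq> {} \<longrightarrow> (\<exists>v\<in>verts H. vdegree H v < t))"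

definition color_class :: "'a mgraph \<Rightarrow> ('a \<Rightarrow> 'c) \<Rightarrow> 'c \<Rightarrow> 'a set" where
  "color_class G \<phi> c = {v \<in> verts G. \<phi> v = c}"

text \<open>Only the values of \<open>\<phi>\<close> on the vertices of \<open>G\<close> matter.\<close>

definition SD_coloring :: "nat \<Rightarrow> 'a mgraph \<Rightarrow> 'c set \<Rightarrow> ('a \<Rightarrow> 'c) \<Rightarrow> bool" where
  "SD_coloring t G \<Gamma> \<phi> \<longleftrightarrow>
     \<phi> \<in> verts G \<rightarrow> \<Gamma> \<and>
     (\<forall>c\<in>\<Gamma>. strictly_degenerate t (induced_subgraph G (color_class G \<phi> c)))"

text \<open>
  Natural numbers suffice as colors, because only the number of colors matters. For \<open>t \<ge> 1\<close> and
  a finite graph the minimum exists: an injective coloring is always admissible.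
\<close>

definition chi :: "nat \<Rightarrow> 'a mgraph \<Rightarrow> nat" where
  "chi t G =
     (LEAST k. \<exists>(\<Gamma> :: nat set) \<phi>. finite \<Gamma> \<and> card \<Gamma> = k \<and> SD_coloring t G \<Gamma> \<phi>)"

definition optimal_SD_coloring :: "nat \<Rightarrow> 'a mgraph \<Rightarrow> 'c set \<Rightarrow> ('a \<Rightarrow> 'c) \<Rightarrow> bool" where
  "optimal_SD_coloring t G \<Gamma> \<phi> \<longleftrightarrow>
     SD_coloring t G \<Gamma> \<phi> \<and> card {c \<in> \<Gamma>. color_class G \<phi> c \<noteq> {}} = chi t G"

definition isolated_colored :: "'a mgraph \<Rightarrow> ('a \<Rightarrow> 'c) \<Rightarrow> 'a set" where
  "isolated_colored G \<phi> = {v \<in> verts G. color_class G \<phi> (\<phi> v) = {v}}"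

definition chi_critical :: "nat \<Rightarrow> 'a mgraph \<Rightarrow> bool" where
  "chi_critical t G \<longleftrightarrow> (\<forall>H. subgraph H G \<and> H \<noteq> G \<longrightarrow> chi t H < chi t G)"

text \<open>
  The complement is meaningful when all multiplicities of \<open>G\<close> are at most \<open>t\<close>, which holds for
  critical graphs; then the natural number subtraction does not truncate.
\<close>

definition t_complement :: "nat \<Rightarrow> 'a mgraph \<Rightarrow> 'a mgraph" where
  "t_complement t G =
     \<lparr> verts = verts G,
       mult = (\<lambda>u v. if u \<in> verts G \<and> v \<in> verts G \<and> u \<noteq> v then t - mult G u v else 0) \<rparr>"

definition connected_graph :: "'a mgraph \<Rightarrow> bool" where
  "connected_graph G \<longleftrightarrow> (\<forall>u\<in>verts G. \<forall>v\<in>verts G. (\<lambda>x y. mult G x y > 0)\<^sup>*\<^sup>* u v)"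

lemma multigraph_induced_subgraph:
  assumes "multigraph G"
  shows "multigraph (induced_subgraph G X)"
  using assms by (auto simp: multigraph_def induced_subgraph_def)

lemma multigraph_t_complement:
  assumes "multigraph G"
  shows "multigraph (t_complement t G)"
  using assms by (auto simp: multigraph_def t_complement_def)

end

theory Submission
  imports Defs
begin

text \<open>
  Sets inducing strictly \<open>t\<close>-degenerate subgraphs form a hereditary family of faces, and
  adjacent vertices of the \<open>t\<close>-complement form faces. Given an optimal coloring \<open>f\<close> and a
  vertex \<open>x\<close>, take among the optimal colorings with class \<open>{x}\<close> one with the fewest singleton classes and, subject to
  that, the most pairs of vertices monochromatic both in it and in \<open>f\<close>. Each of its singleton
  classes \<open>{y}\<close> with \<open>y \<noteq> x\<close> is one of \<open>f\<close>, since otherwise moving a vertex of the \<open>f\<close>-class of \<open>y\<close>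
  to the class of \<open>y\<close> improves the coloring. Two adjacent vertices are never both singleton classes
  of an optimal coloring, so a singleton class can be moved along an edge, and hence along a path,
  without creating other ones. Moving a singleton \<open>u\<close> to a vertex \<open>v\<close> that is already a
  singleton class reduces their number, until only \<open>{v}\<close> is left.
\<close>

section \<open>Optimal colorings by faces of a hereditary family\<close>

text \<open>\<open>F\<close> abstracts strict degeneracy of the induced subgraph and
  \<open>k\<close> the number \<open>chi t G\<close>. Criticality enters through vertex deletions,
  and complement edges enter as pairs that are faces.\<close>

locale critical_hereditary_family =
  fixes V :: "'a set" and F :: "'a set \<Rightarrow> bool" and k :: nat
  assumes finite_V: "finite V"
    and hereditary: "F Y \<Longrightarrow> X \<subseteq> Y \<Longrightarrow> F X"
    and singleton: "x \<in> V \<Longrightarrow> F {x}"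
    and k_le: "\<And>f :: 'a \<Rightarrow> nat. (\<And>c. F {v \<in> V. f v = c}) \<Longrightarrow> k \<le> card (f ` V)"
    and critical: "x \<in> V \<Longrightarrow>
      \<exists>f :: 'a \<Rightarrow> nat. (\<forall>c. F {v \<in> V - {x}. f v = c}) \<and> card (f ` (V - {x})) < k"
    and connected: "x \<in> V \<Longrightarrow> y \<in> V \<Longrightarrow> (\<lambda>u v. u \<in> V \<and> v \<in> V \<and> F {u, v})\<^sup>*\<^sup>* x y"
begin

definition cls :: "('a \<Rightarrow> nat) \<Rightarrow> nat \<Rightarrow> 'a set" where
  "cls f c = {v \<in> V. f v = c}"

definition optimal :: "('a \<Rightarrow> nat) \<Rightarrow> bool" where
  "optimal f \<longleftrightarrow> (\<forall>c. F (cls f c)) \<and> card (f ` V) = k"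

definition singles :: "('a \<Rightarrow> nat) \<Rightarrow> 'a set" where
  "singles f = {v \<in> V. cls f (f v) = {v}}"

lemma finite_singles: "finite (singles f)"
  using finite_V by (simp add: singles_def)

lemma optimalI:
  assumes "\<And>c. F (cls f c)" "card (f ` V) \<le> k"
  shows "optimal f"
  using assms k_le[of f] by (force simp: optimal_def cls_def)

lemma singlesD: "y \<in> singles f \<Longrightarrow> w \<in> V \<Longrightarrow> f w = f y \<Longrightarrow> w = y"
  by (auto simp: singles_def cls_def)

text \<open>Recoloring \<open>y\<close> with \<open>f z\<close> would give up the color
  \<open>f y\<close>, which only \<open>y\<close> uses, and leave fewer than \<open>k\<close>
  classes.\<close>

lemma no_merge:
  assumes f: "optimal f" and y: "y \<in> singles f" and z: "z \<in> V" "z \<noteq> y"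
    and F: "F (insert y (cls f (f z)))"
  shows False
proof -
  let ?g = "f(y := f z)"
  have yV: "y \<in> V" using y by (simp add: singles_def)
  have "F (cls ?g c)" for c
  proof (cases "c = f z")
    case True
    then show ?thesis by (intro hereditary[OF F]) (auto simp: cls_def)
  next
    case False
    moreover have "F (cls f c)" using f by (simp add: optimal_def)
    ultimately show ?thesis by (elim hereditary) (auto simp: cls_def split: if_splits)
  qed
  then have "k \<le> card (?g ` V)" using k_le[of ?g] by (simp add: cls_def)
  also have "?g ` V \<subseteq> f ` V - {f y}" using singlesD[OF y] z by (auto split: if_splits)
  then have "card (?g ` V) \<le> card (f ` V - {f y})"
    using finite_V by (intro card_mono) auto
  also have "\<dots> < card (f ` V)" using yV finite_V by (intro card_Diff1_less) auto
  finally show False using f by (simp add: optimal_def)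
qed

lemma singles_not_adjacent:
  assumes "optimal f" "y \<in> singles f" "z \<in> singles f" "y \<noteq> z"
  shows "\<not> F {y, z}"
proof
  assume "F {y, z}"
  moreover have "cls f (f z) = {z}" "z \<in> V" using assms by (auto simp: singles_def)
  ultimately show False using no_merge[OF assms(1,2), of z] assms(4) by auto
qed

text \<open>The class \<open>{y}\<close> grows to the face \<open>{y, z}\<close>, the old class of
  \<open>z\<close> shrinks, and no color is added.\<close>

lemma optimal_move:
  assumes f: "optimal f" and y: "y \<in> singles f" and z: "z \<in> V" "z \<noteq> y" and F: "F {y, z}"
  shows "optimal (f(z := f y))"
proof (rule optimalI)
  fix c
  show "F (cls (f(z := f y)) c)"
  proof (cases "c = f y")
    case True
    then show ?thesis
      using singlesD[OF y] by (intro hereditary[OF F]) (auto simp: cls_def split: if_splits)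
  next
    case False
    moreover have "F (cls f c)" using f by (simp add: optimal_def)
    ultimately show ?thesis by (elim hereditary) (auto simp: cls_def split: if_splits)
  qed
next
  have "y \<in> V" using y by (simp add: singles_def)
  then have "card (f(z := f y) ` V) \<le> card (f ` V)"
    using finite_V by (intro card_mono) auto
  then show "card (f(z := f y) ` V) \<le> k" using f by (simp add: optimal_def)
qed

text \<open>Only two classes change: that of \<open>y\<close> becomes a pair, and that of
  \<open>z\<close> loses \<open>z\<close>. A new singleton class can thus only be the remainder of a
  two-element class.\<close>

lemma singles_move:
  assumes y: "y \<in> singles f" and z: "z \<in> V" "z \<noteq> y" and w: "w \<in> singles (f(z := f y))"
  shows "w \<noteq> y" "w \<noteq> z" "w \<in> singles f \<or> cls f (f z) = {w, z}"
proof -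
  have yV: "y \<in> V" using y by (simp add: singles_def)
  have wV: "w \<in> V" using w by (simp add: singles_def)
  show wy: "w \<noteq> y" using singlesD[OF w, of z] z by auto
  show wz: "w \<noteq> z" using singlesD[OF w, of y] z yV by auto
  have *: "v = w \<or> v = z" if "v \<in> V" "f v = f w" for v
    using singlesD[OF w, of v] that wz by (auto split: if_splits)
  show "w \<in> singles f \<or> cls f (f z) = {w, z}"
  proof (cases "f z = f w")
    case True
    then show ?thesis using * z wV by (auto simp: cls_def)
  next
    case False
    then have "w \<in> singles f" using * wV by (auto simp: singles_def cls_def)
    then show ?thesis ..
  qed
qed

text \<open>Deleting \<open>x\<close> leaves a coloring with fewer than \<open>k\<close> colors, so
  a fresh color for \<open>x\<close> still keeps the total within \<open>k\<close>.\<close>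

lemma exists_optimal_single:
  assumes x: "x \<in> V"
  shows "\<exists>f. optimal f \<and> x \<in> singles f"
proof -
  obtain f :: "'a \<Rightarrow> nat" where f: "\<And>c. F {v \<in> V - {x}. f v = c}" "card (f ` (V - {x})) < k"
    using critical[OF x] by blast
  obtain d where d: "d \<notin> f ` (V - {x})"
    using finite_V ex_new_if_finite[OF infinite_UNIV_nat, of "f ` (V - {x})"] by auto
  let ?f = "f(x := d)"
  have cx: "cls ?f d = {x}" using d x by (auto simp: cls_def)
  have "optimal ?f"
  proof (rule optimalI)
    fix c
    show "F (cls ?f c)"
    proof (cases "c = d")
      case True
      then show ?thesis using cx singleton[OF x] by simp
    next
      case False
      then show ?thesis by (intro hereditary[OF f(1)[of c]]) (auto simp: cls_def split: if_splits)
    qed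
  next
    have "?f ` V \<subseteq> insert d (f ` (V - {x}))" by auto
    then have "card (?f ` V) \<le> card (insert d (f ` (V - {x})))"
      using finite_V by (intro card_mono) auto
    then show "card (?f ` V) \<le> k" using f(2) finite_V d by simp
  qed
  moreover have "x \<in> singles ?f" using cx x by (simp add: singles_def)
  ultimately show ?thesis by blast
qed

section \<open>Controlling the singleton classes\<close>

text \<open>Comparing pairs rather than colors of vertices makes this independent of how the classes
  are named.\<close>

definition agreement :: "('a \<Rightarrow> nat) \<Rightarrow> ('a \<Rightarrow> nat) \<Rightarrow> ('a \<times> 'a) set" where
  "agreement f g = {(a, b) \<in> V \<times> V. f a = f b \<and> g a = g b}"

lemma agreement_bound: "finite (agreement f g)" "card (agreement f g) \<le> card (V \<times> V)"
proof -
  have "agreement f g \<subseteq> V \<times> V" "finite (V \<times> V)"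
    using finite_V by (auto simp: agreement_def)
  then show "finite (agreement f g)" "card (agreement f g) \<le> card (V \<times> V)"
    by (blast intro: finite_subset card_mono)+
qed

lemma transfer_singles:
  assumes f: "optimal f" and "optimal g" "x \<in> singles g"
  shows "\<exists>h. optimal h \<and> x \<in> singles h \<and> singles h \<subseteq> insert x (singles f)"
  using assms(2,3)
\<comment> \<open>The extremal choice becomes induction on a lexicographic measure; subtracting from
  \<open>card (V \<times> V)\<close> turns growing agreement into descent.\<close>
proof (induction g rule: wf_induct_rule[OF wf_measures[of
      "[\<lambda>g. card (singles g), \<lambda>g. card (V \<times> V) - card (agreement f g)]"]])
  case (1 g)
  show ?case
  proof (cases "singles g \<subseteq> insert x (singles f)")
    case True
    then show ?thesis using 1 by blast
  next
    case False
    then obtain y where y: "y \<in> singles g" "y \<noteq> x" "y \<notin> singles f" by blast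
    have yV: "y \<in> V" using y by (simp add: singles_def)
    then obtain z where z: "z \<in> V" "z \<noteq> y" "f z = f y"
      using y(3) by (auto simp: singles_def cls_def)
    have Fcls: "F (cls f (f y))" using f by (simp add: optimal_def)
    have Fyz: "F {y, z}" by (rule hereditary[OF Fcls]) (use yV z in \<open>auto simp: cls_def\<close>)
    have z_not: "z \<notin> singles g"
      using singles_not_adjacent[OF 1(2) y(1), of z] z Fyz by auto
    let ?h = "g(z := g y)"
    have h: "optimal ?h" by (rule optimal_move[OF 1(2) y(1) z(1,2) Fyz])
    have x_eq: "v = x" if "v \<in> V" "g v = g x" for v using singlesD[OF 1(3)] that by blast
    \<comment> \<open>\<open>z\<close> differs from \<open>x\<close> because it is not a singleton
      class of \<open>g\<close>, and it receives the color of \<open>y\<close>, not that of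
      \<open>x\<close>.\<close>
    have xh: "x \<in> singles ?h"
      using 1(3) y z z_not x_eq yV by (auto simp: singles_def cls_def split: if_splits)
    note move = singles_move[OF y(1) z(1,2)]
    have "(?h, g) \<in> measures
      [\<lambda>g. card (singles g), \<lambda>g. card (V \<times> V) - card (agreement f g)]"
    \<comment> \<open>If \<open>z\<close> leaves a pair, its partner \<open>w\<close> may replace
      \<open>y\<close> as a singleton class and the agreement has to grow. Otherwise the number of
      singleton classes drops.\<close>
    proof (cases "\<exists>w. w \<noteq> z \<and> cls g (g z) = {w, z}")
      case True
      then obtain w where w: "w \<noteq> z" "cls g (g z) = {w, z}" by blast
      have wV: "w \<in> V" "g w = g z" using w by (auto simp: cls_def)
      have "singles ?h \<subseteq> insert w (singles g - {y})"
        using move w by (auto simp: doubleton_eq_iff)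
      then have "card (singles ?h) \<le> card (insert w (singles g - {y}))"
        using finite_singles by (intro card_mono) auto
      also have "\<dots> \<le> Suc (card (singles g - {y}))" by (rule card_insert_le_m1) auto
      also have "\<dots> = card (singles g)"
        by (rule card_Suc_Diff1[OF finite_singles y(1)])
      finally have singles_le: "card (singles ?h) \<le> card (singles g)" .
      \<comment> \<open>otherwise \<open>{w, y, z}\<close> would be a face replacing the two classes \<open>{y}\<close> and \<open>{w, z}\<close>\<close>
      have "f w \<noteq> f z"
      proof
        assume "f w = f z"
        then have "F (insert y (cls g (g z)))"
          by (intro hereditary[OF Fcls]) (use yV z w wV in \<open>auto simp: cls_def\<close>)
        then show False using no_merge[OF 1(2) y(1) z(1,2)] by simp
      qed
      \<comment> \<open>The move separates \<open>z\<close> from \<open>w\<close> alone, and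
        \<open>f\<close> separates these two already, so no agreeing pair is lost while
        \<open>(y, z)\<close> is gained.\<close>
      moreover have "v = w \<or> v = z" if "v \<in> V" "g v = g z" for v
        using w(2) that by (auto simp: cls_def)
      ultimately have "agreement f g \<subseteq> agreement f ?h"
        by (auto simp: agreement_def) metis+
      moreover have "(y, z) \<in> agreement f ?h" "(y, z) \<notin> agreement f g"
        using z yV singlesD[OF y(1), of z] by (auto simp: agreement_def)
      ultimately have "card (agreement f g) < card (agreement f ?h)"
        by (intro psubset_card_mono agreement_bound(1)) auto
      then have "card (V \<times> V) - card (agreement f ?h) < card (V \<times> V) - card (agreement f g)"
        using agreement_bound(2)[of f ?h] by linarith
      then show ?thesis using singles_le by auto
    next
      case False
      then have "singles ?h \<subseteq> singles g - {y}" using move by blast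
      then have "singles ?h \<subset> singles g" using y(1) by blast
      then have "card (singles ?h) < card (singles g)"
        by (intro psubset_card_mono finite_singles)
      then show ?thesis by simp
    qed
    then show ?thesis using 1(1) h xh by blast
  qed
qed

lemma move_single:
  assumes f: "optimal f" "x \<in> singles f" and y: "y \<in> V"
  shows "\<exists>h. optimal h \<and> y \<in> singles h \<and> singles h - {y} \<subseteq> singles f - {x}"
proof -
  have "x \<in> V" using f(2) by (simp add: singles_def)
  then have "(\<lambda>u v. u \<in> V \<and> v \<in> V \<and> F {u, v})\<^sup>*\<^sup>* x y" using connected y by blast
  then show ?thesis
  proof (induction rule: rtranclp_induct)
    case base
    then show ?case using f by blast
  next
    case (step z y)
    then obtain g where g: "optimal g" "z \<in> singles g" "singles g - {z} \<subseteq> singles f - {x}"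
      by blast
    show ?case
    proof (cases "z = y")
      case True
      then show ?thesis using g by blast
    next
      case False
      \<comment> \<open>An optimal coloring with class \<open>{y}\<close> is adapted to
        \<open>g\<close>, so \<open>y\<close> is the only possible new singleton class; adjacency to
        \<open>y\<close> then rules out \<open>z\<close>.\<close>
      obtain h where h: "optimal h" "y \<in> singles h" "singles h \<subseteq> insert y (singles g)"
        using exists_optimal_single[of y] step(2) transfer_singles[OF g(1)] by blast
      have "z \<notin> singles h" using singles_not_adjacent[OF h(1) _ h(2), of z] step(2) False by blast
      then show ?thesis using h g(3) by blast
    qed
  qed
qed

theorem exists_optimal_unique_single:
  assumes v: "v \<in> V"
  shows "\<exists>f. optimal f \<and> singles f = {v}"
proof -
  obtain f where f: "optimal f" "v \<in> singles f" and
    least: "\<And>g. optimal g \<Longrightarrow> v \<in> singles g \<Longrightarrow> card (singles f) \<le> card (singles g)"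
    using exists_optimal_single[OF v]
      ex_has_least_nat[of "\<lambda>f. optimal f \<and> v \<in> singles f" _ "\<lambda>f. card (singles f)"] by blast
  have "u = v" if u: "u \<in> singles f" for u
  proof (rule ccontr)
    assume "u \<noteq> v"
    obtain h where h: "optimal h" "v \<in> singles h" "singles h - {v} \<subseteq> singles f - {u}"
      using move_single[OF f(1) u v] by blast
    then have "singles h \<subset> singles f" using u f(2) \<open>u \<noteq> v\<close> by blast
    then have "card (singles h) < card (singles f)" by (intro psubset_card_mono finite_singles)
    then show False using least[OF h(1,2)] by simp
  qed
  then show ?thesis using f by blast
qed

end

section \<open>Strictly degenerate induced subgraphs\<close>

lemma induced_induced_subgraph:
  assumes "X \<subseteq> Y"
  shows "induced_subgraph (induced_subgraph G Y) X = induced_subgraph G X"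
  using assms by (auto simp: induced_subgraph_def fun_eq_iff)

lemma subgraph_induced_subgraph:
  assumes "multigraph G"
  shows "subgraph (induced_subgraph G X) G"
  using multigraph_induced_subgraph[OF assms, of X]
  by (auto simp: subgraph_def) (auto simp: induced_subgraph_def)

lemma strictly_degenerate_subgraph:
  assumes "strictly_degenerate t G" "subgraph H G"
  shows "strictly_degenerate t H"
proof -
  have "subgraph K G" if "subgraph K H" for K
    using assms(2) that unfolding subgraph_def by (meson order_trans)
  then show ?thesis using assms(1) by (simp add: strictly_degenerate_def)
qed

lemma strictly_degenerate_induced_subset:
  assumes "multigraph G" "strictly_degenerate t (induced_subgraph G Y)" "X \<subseteq> Y"
  shows "strictly_degenerate t (induced_subgraph G X)"
  using strictly_degenerate_subgraph[OF assms(2)]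
    subgraph_induced_subgraph[OF multigraph_induced_subgraph[OF assms(1)], of Y X]
    induced_induced_subgraph[OF assms(3)] by metis

text \<open>On at most two vertices no degree exceeds the multiplicity of the pair. The case
  \<open>x = y\<close> is included and covers single vertices.\<close>

lemma strictly_degenerate_pair:
  assumes G: "multigraph G" and xy: "mult G x y < t"
  shows "strictly_degenerate t (induced_subgraph G {x, y})"
  unfolding strictly_degenerate_def
proof (intro allI impI)
  fix H
  assume H: "subgraph H (induced_subgraph G {x, y}) \<and> verts H \<noteq> {}"
  then obtain v where v: "v \<in> verts H" by blast
  have sub: "verts H \<subseteq> {x, y}" using H by (auto simp: subgraph_def induced_subgraph_def)
  have le: "mult H a b \<le> mult G a b" for a b
  proof -
    have "subgraph H G"
      using H subgraph_induced_subgraph[OF G, of "{x, y}"]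
      unfolding subgraph_def by (meson order_trans)
    then show ?thesis by (simp add: subgraph_def)
  qed
  have loop: "mult G a a = 0" and sym: "mult G a b = mult G b a" for a b
    using G by (auto simp: multigraph_def)
  have "vdegree H v \<le> (\<Sum>u\<in>{x, y}. mult G v u)"
    unfolding vdegree_def by (rule order_trans[OF sum_mono[OF le] sum_mono2]) (use sub in auto)
  also have "\<dots> \<le> mult G x y"
    using v sub loop sym[of y x] by (cases "x = y") auto
  finally show "\<exists>v\<in>verts H. vdegree H v < t" using v xy by (meson le_less_trans)
qed

section \<open>Colorings of multigraphs and \<open>chi\<close>\<close>

lemma SD_coloring_image:
  assumes "SD_coloring t G \<Gamma> f"
  shows "SD_coloring t G (f ` verts G) f"
  using assms by (auto simp: SD_coloring_def)

lemma exists_SD_coloring: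
  assumes G: "multigraph G" and t: "t \<ge> 1"
  shows "\<exists>f :: 'a \<Rightarrow> nat. SD_coloring t (G :: 'a mgraph) (f ` verts G) f"
proof -
  obtain f :: "'a \<Rightarrow> nat" where f: "inj_on f (verts G)"
    using G finite_imp_inj_to_nat_seg by (metis multigraph.finite_verts)
  have "strictly_degenerate t (induced_subgraph G (color_class G f (f x)))" if "x \<in> verts G" for x
  proof -
    \<comment> \<open>Written as a pair to match \<open>strictly_degenerate_pair\<close>.\<close>
    have "color_class G f (f x) = {x, x}"
      using f that by (auto simp: color_class_def inj_on_def)
    moreover have "mult G x x < t" using G t by (simp add: multigraph_def)
    ultimately show ?thesis using strictly_degenerate_pair[OF G] by metis
  qed
  then have "SD_coloring t G (f ` verts G) f" by (auto simp: SD_coloring_def)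
  then show ?thesis by blast
qed

lemma chi_le:
  fixes f :: "'a \<Rightarrow> nat"
  assumes "multigraph G" "SD_coloring t G \<Gamma> f"
  shows "chi t G \<le> card (f ` verts G)"
proof -
  have "finite (f ` verts G)" using assms(1) by (simp add: multigraph_def)
  then show ?thesis
    unfolding chi_def using SD_coloring_image[OF assms(2)] by (intro Least_le) blast
qed

text \<open>A palette of minimum size contains the colors used, and these number at least
  \<open>chi t G\<close> by \<open>chi_le\<close>; so every color of it is used.\<close>

lemma chi_attained:
  fixes G :: "'a mgraph"
  assumes G: "multigraph G" and t: "t \<ge> 1"
  shows "\<exists>f :: 'a \<Rightarrow> nat. SD_coloring t G (f ` verts G) f \<and> card (f ` verts G) = chi t G"
proof -
  have fin: "finite (verts G)" using G by (simp add: multigraph_def)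
  have "\<exists>k (\<Gamma> :: nat set) f. finite \<Gamma> \<and> card \<Gamma> = k \<and> SD_coloring t G \<Gamma> f"
    using exists_SD_coloring[OF G t] fin by blast
  then have "\<exists>(\<Gamma> :: nat set) f. finite \<Gamma> \<and> card \<Gamma> = chi t G \<and> SD_coloring t G \<Gamma> f"
    unfolding chi_def by (rule LeastI_ex)
  then obtain \<Gamma> :: "nat set" and f where
    f: "finite \<Gamma>" "card \<Gamma> = chi t G" "SD_coloring t G \<Gamma> f" by blast
  have "f ` verts G \<subseteq> \<Gamma>" using f(3) by (auto simp: SD_coloring_def)
  then have "card (f ` verts G) \<le> chi t G" using f(1,2) by (metis card_mono)
  then show ?thesis using chi_le[OF G f(3)] SD_coloring_image[OF f(3)] by (meson le_antisym)
qed

lemma SD_coloring_UNIV_iff: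
  "SD_coloring t G (UNIV :: 'c set) f \<longleftrightarrow>
    (\<forall>c :: 'c. strictly_degenerate t (induced_subgraph G {v \<in> verts G. f v = c}))"
  by (simp add: SD_coloring_def color_class_def)

text \<open>Deleting \<open>x\<close> gives a proper subgraph, and a class avoiding \<open>x\<close>
  induces the same graph there as in \<open>G\<close>.\<close>

lemma critical_vertex_deletion:
  fixes G :: "'a mgraph"
  assumes G: "multigraph G" and t: "t \<ge> 1" and crit: "chi_critical t G" and x: "x \<in> verts G"
  shows "\<exists>f :: 'a \<Rightarrow> nat.
    (\<forall>c. strictly_degenerate t (induced_subgraph G {v \<in> verts G - {x}. f v = c})) \<and>
    card (f ` (verts G - {x})) < chi t G"
proof -
  let ?H = "induced_subgraph G (verts G - {x})"
  have H: "verts ?H = verts G - {x}" by (auto simp: induced_subgraph_def)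
  then have "chi t ?H < chi t G"
    using crit x subgraph_induced_subgraph[OF G] unfolding chi_critical_def
    by (metis Diff_iff insertI1)
  moreover obtain f :: "'a \<Rightarrow> nat" where
    f: "SD_coloring t ?H (f ` verts ?H) f" "card (f ` verts ?H) = chi t ?H"
    using chi_attained[OF multigraph_induced_subgraph[OF G] t] by blast
  moreover have "strictly_degenerate t (induced_subgraph G {v \<in> verts G - {x}. f v = c})" for c
  proof (cases "c \<in> f ` verts ?H")
    case True
    then have "strictly_degenerate t (induced_subgraph ?H {v \<in> verts G - {x}. f v = c})"
      using f(1) H by (auto simp: SD_coloring_def color_class_def)
    then show ?thesis by (subst (asm) induced_induced_subgraph) auto
  next
    case False
    then have "{v \<in> verts G - {x}. f v = c} = {}" using H by auto
    then show ?thesis by (auto simp: strictly_degenerate_def subgraph_def induced_subgraph_def)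
  qed
  ultimately show ?thesis using H by metis
qed

theorem theorem21:
  fixes G :: "'a mgraph" and t :: nat
  assumes "multigraph G"
    and "t \<ge> 1"
    and "chi_critical t G"
    and "connected_graph (t_complement t G)"
  shows "\<forall>v\<in>verts G. \<exists>(\<Gamma> :: nat set) \<phi>.
           optimal_SD_coloring t G \<Gamma> \<phi> \<and> isolated_colored G \<phi> = {v}"
proof
  fix v
  assume v: "v \<in> verts G"
  let ?F = "\<lambda>X. strictly_degenerate t (induced_subgraph G X)"
  interpret critical_hereditary_family "verts G" ?F "chi t G"
  proof
    show "finite (verts G)" using assms(1) by (simp add: multigraph_def)
    show "?F X" if "?F Y" "X \<subseteq> Y" for X Y
      using strictly_degenerate_induced_subset[OF assms(1)] that by blast
    show "?F {x}" for x
      using strictly_degenerate_pair[OF assms(1), of x x t] assms(1,2) by (simp add: multigraph_def)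
    show "chi t G \<le> card (f ` verts G)"
      if "\<And>c. ?F {v \<in> verts G. f v = c}" for f :: "'a \<Rightarrow> nat"
      by (rule chi_le[OF assms(1), where \<Gamma> = UNIV]) (simp add: SD_coloring_UNIV_iff that)
    show "\<exists>f :: 'a \<Rightarrow> nat. (\<forall>c. ?F {v \<in> verts G - {x}. f v = c}) \<and>
        card (f ` (verts G - {x})) < chi t G" if "x \<in> verts G" for x
      using critical_vertex_deletion[OF assms(1-3) that] .
    show "(\<lambda>u v. u \<in> verts G \<and> v \<in> verts G \<and> ?F {u, v})\<^sup>*\<^sup>* x y"
      if "x \<in> verts G" "y \<in> verts G" for x y
    \<comment> \<open>Positive multiplicity in the complement means \<open>mult G u v < t\<close>,
      so every path of the complement is a path of faces.\<close>
    proof (rule rtranclp_mono[THEN predicate2D])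
      show "(\<lambda>u v. mult (t_complement t G) u v > 0)\<^sup>*\<^sup>* x y"
        using assms(4) that by (simp add: connected_graph_def t_complement_def)
      show "(\<lambda>u v. mult (t_complement t G) u v > 0) \<le>
          (\<lambda>u v. u \<in> verts G \<and> v \<in> verts G \<and> ?F {u, v})"
        using strictly_degenerate_pair[OF assms(1)]
        by (auto simp: t_complement_def split: if_splits)
    qed
  qed
  obtain f where f: "optimal f" "singles f = {v}"
    using exists_optimal_unique_single[OF v] by blast
  \<comment> \<open>The palette \<open>UNIV\<close> is infinite, but optimality counts only its
    non-empty classes.\<close>
  have "{c \<in> UNIV. color_class G f c \<noteq> {}} = f ` verts G" by (auto simp: color_class_def)
  then have "optimal_SD_coloring t G UNIV f"
    using f(1) by (simp add: optimal_SD_coloring_def optimal_def cls_def SD_coloring_UNIV_iff)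
  moreover have "isolated_colored G f = {v}"
    using f(2) by (simp add: isolated_colored_def singles_def color_class_def cls_def)
  ultimately show "\<exists>(\<Gamma> :: nat set) \<phi>. optimal_SD_coloring t G \<Gamma> \<phi> \<and> isolated_colored G \<phi> = {v}"
    by blast
qed

end
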